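(* Let $y_0\in Y$ and assume that the closure of the reachable set $\mathcal{R}_{y_0}$ has nonempty interior in $\mathbb{R}^m$: $\mathrm{int}(\mathrm{cl}\,\mathcal{R}_{y_0})\neq\emptyset$. Then for every $N$ a solution of the $N$-approximating problem exists, i.e. there is $\psi\in D_N$ such that $$\min_{(y,u)\in G}\{g(y,u)+\alpha(\psi(f(y,u))-\psi(y))+(1-\alpha)(\psi(y_0)-\psi(y))\}=\mu_N^*(y_0).$$
   Context: Setting: $Y\subset\mathbb{R}^m$ is nonempty and compact, $U_0$ is a compact metric space, $U(\cdot)$ is an upper semicontinuous compact-valued set-valued map from $Y$ to $U_0$, $f:\mathbb{R}^m\times U_0\to\mathbb{R}^m$ and $g:\mathbb{R}^m\times U_0\to\mathbb{R}$ are continuous, and $\alpha\in(0,1)$. Put $A(y):=\{u\in U(y): f(y,u)\in Y\}$ for $y\in Y$ and $G:=\{(y,u): y\in Y,\ u\in A(y)\}$ (a compact set). Standing assumption: $A(y)\neq\emptyset$ for every $y\in Y$. An admissible process starting at $y_0\in Y$ is a pair of sequences $(y(t),u(t))_{t\ge0}$ with $y(0)=y_0$, $u(t)\in A(y(t))$ and $y(t+1)=f(y(t),u(t))$ for all $t\in\{0,1,\dots\}$. The reachable set $\mathcal{R}_{y_0}$ is the set of all points $y(t)$, over all admissible processes starting at $y_0$ and all $t\in\{0,1,\dots\}$. Let $\{\phi_i\}_{i=1}^\infty$ be a sequence of continuous real-valued functions on $Y$ with $\phi_1\equiv1$ such that: (i) any finite collection of functions from the sequence is linearly independent on any nonempty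 open set (open subset of $\mathbb{R}^m$ contained in $Y$); (ii) for any $\psi\in C(Y)$ and $\delta>0$ there exist $N$ and real $\lambda_1,\dots,\lambda_N$ with $\max_{y\in Y}|\psi(y)-\sum_{i=1}^N\lambda_i\phi_i(y)|\le\delta$. Let $D_N:=\{\sum_{i=1}^N\lambda_i\phi_i:\lambda_i\in\mathbb{R}\}\subset C(Y)$. The $N$-approximating problem has optimal value $$\mu_N^*(y_0):=\sup_{\psi\in D_N}\min_{(y,u)\in G}\{g(y,u)+\alpha(\psi(f(y,u))-\psi(y))+(1-\alpha)(\psi(y_0)-\psi(y))\}.$$ *)

theory Defs
  imports "HOL-Analysis.Analysis"
begin

definition usc_on :: "'a::topological_space set \<Rightarrow> 'b::topological_space set \<Rightarrow> ('a \<Rightarrow> 'b set) \<Rightarrow> bool"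
  where "usc_on Y U0 U \<longleftrightarrow>
    (\<forall>y\<in>Y. \<forall>V. openin (top_of_set U0) V \<and> U y \<subseteq> V \<longrightarrow>
      (\<exists>W. openin (top_of_set Y) W \<and> y \<in> W \<and> (\<forall>z\<in>W. U z \<subseteq> V)))"

definition admissible_controls ::
    "'a set \<Rightarrow> ('a \<Rightarrow> 'u set) \<Rightarrow> ('a \<times> 'u \<Rightarrow> 'a) \<Rightarrow> 'a \<Rightarrow> 'u set"
  where "admissible_controls Y U f y = {u \<in> U y. f (y, u) \<in> Y}"

definition control_graph ::
    "'a set \<Rightarrow> ('a \<Rightarrow> 'u set) \<Rightarrow> ('a \<times> 'u \<Rightarrow> 'a) \<Rightarrow> ('a \<times> 'u) set"
  where "control_graph Y U f = (SIGMA y:Y. admissible_controls Y U f y)"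

definition admissible_process ::
    "'a set \<Rightarrow> ('a \<Rightarrow> 'u set) \<Rightarrow> ('a \<times> 'u \<Rightarrow> 'a) \<Rightarrow> 'a \<Rightarrow> (nat \<Rightarrow> 'a) \<Rightarrow> (nat \<Rightarrow> 'u) \<Rightarrow> bool"
  where "admissible_process Y U f y0 y u \<longleftrightarrow>
    y 0 = y0 \<and> (\<forall>t. u t \<in> admissible_controls Y U f (y t) \<and> y (Suc t) = f (y t, u t))"

definition reachable_set ::
    "'a set \<Rightarrow> ('a \<Rightarrow> 'u set) \<Rightarrow> ('a \<times> 'u \<Rightarrow> 'a) \<Rightarrow> 'a \<Rightarrow> 'a set"
  where "reachable_set Y U f y0 = {y t | y u t. admissible_process Y U f y0 y u}"

(* Sequences of functions are indexed from 1; the value at index 0 is never used. *)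

definition locally_independent :: "'a::topological_space set \<Rightarrow> (nat \<Rightarrow> 'a \<Rightarrow> real) \<Rightarrow> bool"
  where "locally_independent Y \<phi> \<longleftrightarrow>
    (\<forall>Q I c. open Q \<and> Q \<noteq> {} \<and> Q \<subseteq> Y \<and> finite I \<and> I \<subseteq> {1..} \<and>
      (\<forall>y\<in>Q. (\<Sum>i\<in>I. c i * \<phi> i y) = 0) \<longrightarrow> (\<forall>i\<in>I. c i = 0))"

definition uniformly_spanning :: "'a::topological_space set \<Rightarrow> (nat \<Rightarrow> 'a \<Rightarrow> real) \<Rightarrow> bool"
  where "uniformly_spanning Y \<phi> \<longleftrightarrow>
    (\<forall>\<psi> \<delta>. continuous_on Y \<psi> \<and> \<delta> > 0 \<longrightarrow>
      (\<exists>N c. \<forall>y\<in>Y. \<bar>\<psi> y - (\<Sum>i=1..N. c i * \<phi> i y)\<bar> \<le> \<delta>))"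

(* The members are total functions, but only their values on Y are relevant below:
   (y, u) in the control graph forces both y and f (y, u) to lie in Y. *)
definition test_space :: "(nat \<Rightarrow> 'a \<Rightarrow> real) \<Rightarrow> nat \<Rightarrow> ('a \<Rightarrow> real) set"
  where "test_space \<phi> N = {\<lambda>y. \<Sum>i=1..N. c i * \<phi> i y | c. True}"

definition dual_integrand ::
    "('a \<times> 'u \<Rightarrow> 'a) \<Rightarrow> ('a \<times> 'u \<Rightarrow> real) \<Rightarrow> real \<Rightarrow> 'a \<Rightarrow> ('a \<Rightarrow> real) \<Rightarrow> 'a \<times> 'u \<Rightarrow> real"
  where "dual_integrand f g \<alpha> y0 \<psi> = (\<lambda>(y, u).
    g (y, u) + \<alpha> * (\<psi> (f (y, u)) - \<psi> y) + (1 - \<alpha>) * (\<psi> y0 - \<psi> y))"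

(* A genuine minimum, i.e. the least element of the set of attained values. *)
definition dual_value ::
    "'a set \<Rightarrow> ('a \<Rightarrow> 'u set) \<Rightarrow> ('a \<times> 'u \<Rightarrow> 'a) \<Rightarrow> ('a \<times> 'u \<Rightarrow> real) \<Rightarrow> real \<Rightarrow> 'a \<Rightarrow>
      ('a \<Rightarrow> real) \<Rightarrow> real"
  where "dual_value Y U f g \<alpha> y0 \<psi> =
    (LEAST v. v \<in> dual_integrand f g \<alpha> y0 \<psi> ` control_graph Y U f)"

(* Extended-real supremum, so that no boundedness is presupposed. *)
definition approx_value ::
    "'a set \<Rightarrow> ('a \<Rightarrow> 'u set) \<Rightarrow> ('a \<times> 'u \<Rightarrow> 'a) \<Rightarrow> ('a \<times> 'u \<Rightarrow> real) \<Rightarrow> real \<Rightarrow>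
      (nat \<Rightarrow> 'a \<Rightarrow> real) \<Rightarrow> nat \<Rightarrow> 'a \<Rightarrow> ereal"
  where "approx_value Y U f g \<alpha> \<phi> N y0 =
    (SUP \<psi>\<in>test_space \<phi> N. ereal (dual_value Y U f g \<alpha> y0 \<psi>))"

end

theory Submission
  imports Defs
begin

text \<open>
  Let \<open>\<psi> = \<Sum>i\<le>N. c i * \<phi> i\<close> and \<open>\<theta> = \<psi> - \<psi> y0\<close>. Adding \<open>\<phi> 1\<close> to \<open>\<psi>\<close> changes nothing, so one may fix \<open>c 1 = 0\<close>,
  and the objective is \<open>min (g + L c)\<close> with \<open>L c (y, u) = \<alpha> * \<theta> (f (y, u)) - \<theta> y\<close> linear in \<open>c\<close>. If
  \<open>L c \<ge> 0\<close> on the control graph, then evaluating at a maximum point of \<open>\<theta>\<close> gives \<open>\<theta> \<le> 0\<close>, while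
  \<open>\<theta> y0 = 0\<close> propagates along processes to \<open>\<theta> \<ge> 0\<close> on the reachable set. So \<open>\<theta> = 0\<close> on an open set
  and \<open>c = 0\<close> by independence. Hence \<open>min L c\<close> is negative on the unit sphere, uniformly so by
  compactness; the objective tends to \<open>-\<infinity>\<close> with the size of \<open>c\<close>, and attains its supremum.
\<close>

section \<open>Maximization of a minimum over compact sets\<close>

text \<open>The function \<open>c \<mapsto> min h c\<close> is upper semicontinuous, its superlevel
  sets being intersections of closed ones. Instead of a general theorem on such functions, the
  finite intersection property is applied to the sets \<open>A c'\<close> of points at least as good
  as \<open>c'\<close>. The last two conclusions say that \<open>h c x\<close> is the minimum for
  \<open>c\<close> and bounds that for every \<open>c'\<close>.\<close>

lemma max_min_compact:
  fixes h :: "'c::t2_space \<Rightarrow> 'x::topological_space \<Rightarrow> real"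
  assumes "compact K" "K \<noteq> {}" "compact X" "X \<noteq> {}"
    and contX: "\<And>c. c \<in> K \<Longrightarrow> continuous_on X (h c)"
    and contK: "\<And>x. x \<in> X \<Longrightarrow> continuous_on K (\<lambda>c. h c x)"
  obtains c x where "c \<in> K" "x \<in> X" "\<And>x'. x' \<in> X \<Longrightarrow> h c x \<le> h c x'"
    "\<And>c'. c' \<in> K \<Longrightarrow> \<exists>x'\<in>X. h c' x' \<le> h c x"
proof -
  have "\<exists>x\<in>X. \<forall>x'\<in>X. h c x \<le> h c x'" if "c \<in> K" for c
    using continuous_attains_inf[OF assms(3,4) contX[OF that]] by blast
  then obtain m where m: "\<And>c. c \<in> K \<Longrightarrow> m c \<in> X"
    "\<And>c x. c \<in> K \<Longrightarrow> x \<in> X \<Longrightarrow> h c (m c) \<le> h c x"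
    by metis
  define A where "A c' = {c\<in>K. \<forall>x\<in>X. h c' (m c') \<le> h c x}" for c'
  have "closed K" using assms(1) by (rule compact_imp_closed)
  have clA: "closed (A c')" for c'
  proof -
    have "A c' = K \<inter> (\<Inter>x\<in>X. {c\<in>K. h c' (m c') \<le> h c x})"
      using \<open>X \<noteq> {}\<close> by (auto simp: A_def)
    moreover have "closed {c\<in>K. h c' (m c') \<le> h c x}" if "x \<in> X" for x
      using continuous_closed_preimage[OF contK[OF that] \<open>closed K\<close>, of "{h c' (m c')..}"]
      by (simp add: Int_def vimage_def)
    ultimately show ?thesis using \<open>closed K\<close> by (simp only:) (intro closed_Int closed_INT ballI; assumption)
  qed
  have "K \<inter> (\<Inter>c'\<in>K. A c') \<noteq> {}"
  proof (rule compact_imp_fip_image[OF assms(1) clA])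
    fix J assume J: "finite J" "J \<subseteq> K"
    show "K \<inter> (\<Inter>c'\<in>J. A c') \<noteq> {}"
    proof (cases "J = {}")
      case True
      then show ?thesis using \<open>K \<noteq> {}\<close> by simp
    next
      case False
      \<comment> \<open>The member of \<open>J\<close> with the largest minimum lies in every
        \<open>A c'\<close> with \<open>c'\<close> in \<open>J\<close>.\<close>
      define v where "v = Max ((\<lambda>c. h c (m c)) ` J)"
      have "v \<in> (\<lambda>c. h c (m c)) ` J"
        unfolding v_def using J False by (intro Max_in) auto
      then obtain c where c: "c \<in> J" "v = h c (m c)" by blast
      have "h c' (m c') \<le> h c (m c)" if "c' \<in> J" for c'
        unfolding c(2)[symmetric] v_def using that J by (intro Max_ge) auto
      then have "c \<in> A c'" if "c' \<in> J" for c'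
        unfolding A_def using that c J m(2)[of c] by force
      then show ?thesis using c J by blast
    qed
  qed
  then obtain c where c: "c \<in> K" "\<And>c'. c' \<in> K \<Longrightarrow> c \<in> A c'" by blast
  show thesis
  proof (rule that[of c "m c"])
    show "\<exists>x'\<in>X. h c' x' \<le> h c (m c)" if "c' \<in> K" for c'
      using c(2)[OF that] m(1)[OF that] m(1)[OF c(1)] by (auto simp: A_def)
  qed (use c m in auto)
qed

text \<open>Tychonoff: the set is closed in a product of intervals and singletons. Coefficients
  outside \<open>I\<close> are pinned to 0, since free coordinates would destroy
  compactness.\<close>

lemma compact_l1_ball:
  fixes I :: "'i::countable set"
  assumes "finite I"
  shows "compact {c :: 'i \<Rightarrow> real. (\<forall>i. i \<notin> I \<longrightarrow> c i = 0) \<and> (\<Sum>i\<in>I. \<bar>c i\<bar>) \<le> r}" (is "compact ?B")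
proof -
  let ?P = "PiE UNIV (\<lambda>i::'i. if i \<in> I then {-r..r} else {0})"
  have "compactin (product_topology (\<lambda>i. euclidean) UNIV) ?P"
    unfolding compactin_PiE by auto
  then have "compact ?P" by (simp add: euclidean_product_topology)
  moreover have "closed {c :: 'i \<Rightarrow> real. (\<Sum>i\<in>I. \<bar>c i\<bar>) \<le> r}"
    by (intro closed_Collect_le continuous_intros) auto
  moreover have "?B = ?P \<inter> {c. (\<Sum>i\<in>I. \<bar>c i\<bar>) \<le> r}"
  proof -
    have "\<bar>c i\<bar> \<le> r" if "(\<Sum>i\<in>I. \<bar>c i\<bar>) \<le> r" "i \<in> I" for c :: "'i \<Rightarrow> real" and i
      using member_le_sum[OF that(2), of "\<lambda>i. \<bar>c i\<bar>"] that(1) assms by auto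
    then show ?thesis by (fastforce simp: PiE_iff abs_le_iff split: if_splits)
  qed
  ultimately show ?thesis by (simp add: compact_Int_closed)
qed

text \<open>The abstract form of the problem: \<open>nondeg\<close> makes the concave objective
  coercive, so a maximizer over a large ball is global. The order of quantifiers expresses that the
  minimum for \<open>c'\<close> is at most the minimum for \<open>c\<close>.\<close>

lemma linear_max_min_attained:
  fixes X :: "'x::topological_space set" and I :: "'i::countable set" and l :: "'i \<Rightarrow> 'x \<Rightarrow> real"
  assumes X: "compact X" "X \<noteq> {}" and I: "finite I"
    and g: "continuous_on X g" and l: "\<And>i. i \<in> I \<Longrightarrow> continuous_on X (l i)"
    and nondeg: "\<And>c i. (\<And>x. x \<in> X \<Longrightarrow> 0 \<le> (\<Sum>j\<in>I. c j * l j x)) \<Longrightarrow> i \<in> I \<Longrightarrow> c i = 0"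
  shows "\<exists>c. \<forall>c'. \<exists>x'\<in>X. \<forall>x\<in>X.
    g x' + (\<Sum>i\<in>I. c' i * l i x') \<le> g x + (\<Sum>i\<in>I. c i * l i x)"
proof -
  define L where "L c x = (\<Sum>i\<in>I. c i * l i x)" for c x
  define S where "S c = (\<Sum>i\<in>I. \<bar>c i :: real\<bar>)" for c
  define B where "B r = {c. (\<forall>i. i \<notin> I \<longrightarrow> c i = 0) \<and> S c \<le> r}" for r
  \<comment> \<open>Truncation moves a coefficient family into the compact model \<open>B r\<close>
    without changing its combination or its norm.\<close>
  define supp where "supp c = (\<lambda>i. if i \<in> I then c i else 0 :: real)" for c
  have supp: "L (supp c) = L c" "S (supp c) = S c" "supp c i = 0 \<longleftrightarrow> i \<notin> I \<or> c i = 0" for c i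
    by (auto simp: supp_def L_def S_def fun_eq_iff)
  have S0: "0 \<le> S c" for c by (simp add: S_def sum_nonneg)
  have LS0: "L c x = 0" if "S c = 0" for c x
    using that I by (simp add: L_def S_def sum_nonneg_eq_0_iff)
  have contS: "continuous_on UNIV S" unfolding S_def by (intro continuous_intros) auto
  have contK: "continuous_on K (\<lambda>c. L c x)" for K x
    unfolding L_def by (intro continuous_intros continuous_on_subset[OF continuous_on_product_coordinates]) auto
  have contX: "continuous_on X (L c)" for c
    unfolding L_def by (intro continuous_intros l)
  have cB: "compact (B r)" for r unfolding B_def S_def by (rule compact_l1_ball[OF I])
  define T where "T = B 1 \<inter> {c. S c = 1}"
  have cT: "compact T" unfolding T_def
    by (intro compact_Int_closed cB closed_Collect_eq contS continuous_intros)
  have normalize: "supp (\<lambda>i. c i / S c) \<in> T" if "S c \<noteq> 0" for c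
  proof -
    have "S (\<lambda>i. c i / S c) = S c / S c"
      using S0[of c] unfolding S_def by (simp only: abs_divide abs_of_nonneg sum_divide_distrib)
    then show ?thesis using that by (auto simp: T_def B_def supp)
  qed
  obtain \<beta> where \<beta>: "\<beta> > 0" "\<And>c. \<exists>x\<in>X. L c x \<le> - \<beta> * S c"
  proof (cases "T = {}")
    \<comment> \<open>By \<open>normalize\<close> all norms vanish, as happens for empty
      \<open>I\<close>; then \<open>L\<close> is zero and any positive \<open>\<beta>\<close>
      serves.\<close>
    case True
    then have "S c = 0" for c using normalize by blast
    then show thesis using that[of 1] LS0 X by auto
  next
    case False
    obtain c x where cx: "c \<in> T" "x \<in> X" "\<And>x'. x' \<in> X \<Longrightarrow> L c x \<le> L c x'"
      "\<And>c'. c' \<in> T \<Longrightarrow> \<exists>x'\<in>X. L c' x' \<le> L c x"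
      using max_min_compact[OF cT False X contX contK] by metis
    have neg: "L c x < 0"
    proof (rule ccontr)
      assume "\<not> L c x < 0"
      then have "0 \<le> L c x'" if "x' \<in> X" for x' using cx(3)[OF that] by simp
      then have "S c = 0" using nondeg[of c] by (simp add: S_def L_def)
      then show False using cx(1) by (simp add: T_def)
    qed
    \<comment> \<open>The bound on the sphere extends to all \<open>c'\<close> by homogeneity of
      \<open>L\<close>; the rate is the negative of the largest minimum on \<open>T\<close>.\<close>
    have "\<exists>x'\<in>X. L c' x' \<le> - (- L c x) * S c'" for c'
    proof (cases "S c' = 0")
      case True
      then show ?thesis using LS0 X by auto
    next
      case False
      obtain x' where x': "x' \<in> X" "L (\<lambda>i. c' i / S c') x' \<le> L c x"
        using cx(4)[OF normalize[OF False]] by (auto simp: supp)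
      have "L (\<lambda>i. c' i / S c') x' = L c' x' / S c'"
        by (simp add: L_def sum_divide_distrib)
      then have "L c' x' \<le> L c x * S c'"
        using x'(2) False S0[of c'] by (simp add: divide_le_eq)
      then show ?thesis using x'(1) by auto
    qed
    then show thesis using that[of "- L c x"] neg by auto
  qed
  obtain a where a: "a \<in> X" "\<And>x. x \<in> X \<Longrightarrow> g a \<le> g x"
    using continuous_attains_inf[OF X g] by blast
  obtain b where b: "b \<in> X" "\<And>x. x \<in> X \<Longrightarrow> g x \<le> g b"
    using continuous_attains_sup[OF X g] by blast
  \<comment> \<open>Beyond this radius the decay \<open>\<beta> * S c'\<close> exceeds the
    oscillation of \<open>g\<close>, so the minimum drops below \<open>g a\<close>, the value
    achieved by zero coefficients.\<close>
  define R where "R = (g b - g a) / \<beta>"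
  have "0 \<le> R" using b(2)[OF a(1)] \<beta>(1) by (simp add: R_def)
  then have zero: "(\<lambda>_. 0) \<in> B R" by (simp add: B_def S_def)
  then have ne: "B R \<noteq> {}" by blast
  obtain c x where cx: "c \<in> B R" "x \<in> X" "\<And>x'. x' \<in> X \<Longrightarrow> g x + L c x \<le> g x' + L c x'"
    "\<And>c'. c' \<in> B R \<Longrightarrow> \<exists>x'\<in>X. g x' + L c' x' \<le> g x + L c x"
  proof (rule max_min_compact[OF cB ne X, of "\<lambda>c x. g x + L c x"])
    show "continuous_on X (\<lambda>x. g x + L c x)" for c by (intro continuous_intros g contX)
    show "continuous_on (B R) (\<lambda>c. g x + L c x)" for x by (intro continuous_intros contK)
  qed blast
  have "\<exists>x'\<in>X. g x' + L c' x' \<le> g x + L c x" for c'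
  proof (cases "S c' \<le> R")
    case True
    then have "supp c' \<in> B R" by (simp add: B_def supp)
    from cx(4)[OF this] show ?thesis by (simp add: supp)
  next
    case False
    obtain x' where x': "x' \<in> X" "L c' x' \<le> - \<beta> * S c'" using \<beta>(2) by blast
    \<comment> \<open>Comparison with zero coefficients: the optimum over the ball is at least
      \<open>g x''\<close>, hence at least \<open>g a\<close>.\<close>
    obtain x'' where x'': "x'' \<in> X" "g x'' \<le> g x + L c x"
      using cx(4)[OF zero] by (auto simp: L_def)
    have "\<beta> * R \<le> \<beta> * S c'" using False \<beta>(1) by simp
    then have "L c' x' \<le> g a - g b" using x'(2) \<beta>(1) by (simp add: R_def)
    then show ?thesis using x' x'' a(2)[OF x''(1)] b(2)[OF x'(1)] by (intro bexI[of _ x']) auto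
  qed
  then have "\<forall>c'. \<exists>x'\<in>X. \<forall>z\<in>X. g x' + L c' x' \<le> g z + L c z"
    using cx(3) by (meson order_trans)
  then show ?thesis unfolding L_def by (rule exI[of _ c])
qed

section \<open>Compactness of the control graph\<close>

text \<open>An upper semicontinuous map with compact values has a closed graph, and the constraint
  \<open>f (y, u) \<in> Y\<close> is closed as well; both survive limits inside the compact set
  \<open>Y \<times> U0\<close>.\<close>

lemma compact_control_graph:
  fixes Y :: "'a::metric_space set" and U0 :: "'u::metric_space set"
  assumes "compact Y" "compact U0"
    and U: "\<And>y. y \<in> Y \<Longrightarrow> U y \<subseteq> U0 \<and> compact (U y)"
    and usc: "usc_on Y U0 U"
    and f: "continuous_on (Y \<times> U0) f"
  shows "compact (control_graph Y U f)"
proof -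
  let ?G = "control_graph Y U f"
  have sub: "?G \<subseteq> Y \<times> U0"
    using U by (auto simp: control_graph_def admissible_controls_def)
  have cYU: "compact (Y \<times> U0)" using assms(1,2) by (rule compact_Times)
  have "closed ?G"
    unfolding closed_sequential_limits
  proof (intro allI impI, elim conjE)
    fix s p assume s: "\<forall>n. s n \<in> ?G" and lim: "s \<longlonglongrightarrow> p"
    obtain y u where p: "p = (y, u)" by (cases p)
    have pYU: "p \<in> Y \<times> U0"
      using closed_sequentially[OF compact_imp_closed[OF cYU] _ lim] s sub by blast
    have yY: "y \<in> Y" using pYU p by simp
    have limy: "(\<lambda>n. fst (s n)) \<longlonglongrightarrow> y" and limu: "(\<lambda>n. snd (s n)) \<longlonglongrightarrow> u"
      using tendsto_fst[OF lim] tendsto_snd[OF lim] p by auto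
    have "u \<in> U y"
    proof (rule ccontr)
      assume "u \<notin> U y"
      moreover have "closed (U y)" using U[OF yY] compact_imp_closed by blast
      ultimately obtain e where e: "e > 0" "ball u e \<subseteq> - U y"
        by (metis ComplI open_Compl open_contains_ball)
      \<comment> \<open>Halving the radius makes the removed ball closed, so that \<open>?V\<close>
        is relatively open and still contains \<open>U y\<close>. Controls at nearby states then
        avoid the ball into which \<open>snd (s n)\<close> converges.\<close>
      let ?V = "U0 \<inter> - cball u (e/2)"
      have "openin (top_of_set U0) ?V" by (intro openin_open_Int) auto
      moreover have "U y \<subseteq> ?V" using U[OF yY] e by (auto simp: subset_iff)
      ultimately obtain W where W: "openin (top_of_set Y) W" "y \<in> W" "\<forall>z\<in>W. U z \<subseteq> ?V"
        using usc yY unfolding usc_on_def by meson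
      obtain Q where Q: "open Q" "W = Y \<inter> Q" using W(1) by (auto simp: openin_open)
      have "eventually (\<lambda>n. fst (s n) \<in> Q) sequentially"
        using topological_tendstoD[OF limy Q(1)] W Q by auto
      moreover have "eventually (\<lambda>n. snd (s n) \<in> ball u (e/2)) sequentially"
        using topological_tendstoD[OF limu, of "ball u (e/2)"] e by auto
      ultimately have "eventually (\<lambda>n. False) sequentially"
      proof eventually_elim
        case (elim n)
        have "fst (s n) \<in> W" "snd (s n) \<in> U (fst (s n))"
          using s[rule_format, of n] elim(1) Q
          by (auto simp: control_graph_def admissible_controls_def)
        then have "snd (s n) \<in> ?V" using W(3) by blast
        then show ?case using elim(2) by auto
      qed
      then show False by simp
    qed
    moreover have "f p \<in> Y"
    proof (rule closed_sequentially[OF compact_imp_closed[OF assms(1)]])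
      show "f (s n) \<in> Y" for n
        using s[rule_format, of n] by (auto simp: control_graph_def admissible_controls_def)
      show "(\<lambda>n. f (s n)) \<longlonglongrightarrow> f p"
        by (rule continuous_on_tendsto_compose[OF f lim pYU]) (use s sub in \<open>auto intro!: always_eventually\<close>)
    qed
    ultimately show "p \<in> ?G" using yY p by (simp add: control_graph_def admissible_controls_def)
  qed
  then have "compact ((Y \<times> U0) \<inter> ?G)" using cYU by (rule compact_Int_closed[rotated])
  then show ?thesis using sub by (simp add: Int_absorb1)
qed

section \<open>Functions on the reachable set\<close>

lemma reachable_set_subset:
  assumes "y0 \<in> Y"
  shows "reachable_set Y U f y0 \<subseteq> Y"
proof -
  have "y t \<in> Y" if "admissible_process Y U f y0 y u" for y u t
    using that assms by (cases t) (auto simp: admissible_process_def admissible_controls_def)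
  then show ?thesis by (auto simp: reachable_set_def)
qed

text \<open>Two opposite bounds: at a maximum point discounting forces
  \<open>\<theta> \<le> 0\<close> on all of \<open>Y\<close>, while nonnegativity travels forward
  from \<open>y0\<close> along processes. Continuity carries the resulting zero to the
  closure.\<close>

lemma discounted_increase_vanishes:
  fixes Y :: "'a::topological_space set"
  assumes Y: "compact Y" "Y \<noteq> {}" "closed Y" and "y0 \<in> Y" and \<alpha>: "0 < \<alpha>" "\<alpha> < 1"
    and ne: "\<And>y. y \<in> Y \<Longrightarrow> admissible_controls Y U f y \<noteq> {}"
    and cont: "continuous_on Y \<theta>" and \<theta>0: "\<theta> y0 = 0"
    and ineq: "\<And>y u. (y, u) \<in> control_graph Y U f \<Longrightarrow> \<theta> y \<le> \<alpha> * \<theta> (f (y, u))"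
    and y: "y \<in> closure (reachable_set Y U f y0)"
  shows "\<theta> y = (0::real)"
proof -
  let ?R = "reachable_set Y U f y0"
  obtain z where z: "z \<in> Y" "\<And>x. x \<in> Y \<Longrightarrow> \<theta> x \<le> \<theta> z"
    using continuous_attains_sup[OF Y(1,2) cont] by blast
  \<comment> \<open>Any admissible control at the maximum point will do, since its successor stays
    in \<open>Y\<close>.\<close>
  obtain v where v: "v \<in> admissible_controls Y U f z" using ne[OF z(1)] by blast
  have "\<theta> z \<le> \<alpha> * \<theta> (f (z, v))"
    using ineq z(1) v by (simp add: control_graph_def)
  also have "\<dots> \<le> \<alpha> * \<theta> z"
    using z(2) v \<alpha> by (auto simp: admissible_controls_def)
  finally have "(1 - \<alpha>) * \<theta> z \<le> 0" by (simp add: algebra_simps)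
  then have le: "\<theta> x \<le> 0" if "x \<in> Y" for x
    using z(2)[OF that] \<alpha> by (auto simp: mult_le_0_iff)
  have "0 \<le> \<theta> (p t)" if p: "admissible_process Y U f y0 p q" for p q t
  proof (induction t)
    case 0
    then show ?case using p \<theta>0 by (simp add: admissible_process_def)
  next
    case (Suc t)
    have "p t \<in> ?R" using p by (auto simp: reachable_set_def)
    then have "p t \<in> Y" using reachable_set_subset[OF \<open>y0 \<in> Y\<close>] by blast
    then have "(p t, q t) \<in> control_graph Y U f"
      using p by (simp add: control_graph_def admissible_process_def)
    from ineq[OF this] have "\<theta> (p t) \<le> \<alpha> * \<theta> (p (Suc t))"
      using p by (simp add: admissible_process_def)
    then show ?case using Suc \<alpha>(1) zero_le_mult_iff[of \<alpha> "\<theta> (p (Suc t))"] by linarith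
  qed
  then have ge: "0 \<le> \<theta> x" if "x \<in> ?R" for x
    using that by (auto simp: reachable_set_def)
  have zero: "\<theta> x = 0" if "x \<in> ?R" for x
    using le[of x] ge[OF that] subsetD[OF reachable_set_subset[OF \<open>y0 \<in> Y\<close>] that] by simp
  \<comment> \<open>\<open>\<theta>\<close> is continuous only on \<open>Y\<close>, so the closure
    must stay there.\<close>
  have "closure ?R \<subseteq> Y"
    using reachable_set_subset[OF \<open>y0 \<in> Y\<close>] Y(3) by (rule closure_minimal)
  then show ?thesis
    using continuous_constant_on_closure[OF continuous_on_subset[OF cont] zero y] by simp
qed

section \<open>Application to the approximating problem\<close>

text \<open>\<open>LEAST\<close> on the reals is informative only once a least value exists;
  compactness supplies it.\<close>

lemma dual_value_attained:
  assumes "compact (control_graph Y U f)" "control_graph Y U f \<noteq> {}"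
    and "continuous_on (control_graph Y U f) (dual_integrand f g \<alpha> y0 \<psi>)"
  shows "dual_value Y U f g \<alpha> y0 \<psi> \<in> dual_integrand f g \<alpha> y0 \<psi> ` control_graph Y U f"
    and "p \<in> control_graph Y U f \<Longrightarrow> dual_value Y U f g \<alpha> y0 \<psi> \<le> dual_integrand f g \<alpha> y0 \<psi> p"
proof -
  obtain x where x: "x \<in> control_graph Y U f"
    "\<And>x'. x' \<in> control_graph Y U f \<Longrightarrow> dual_integrand f g \<alpha> y0 \<psi> x \<le> dual_integrand f g \<alpha> y0 \<psi> x'"
    using continuous_attains_inf[OF assms] by blast
  have "dual_value Y U f g \<alpha> y0 \<psi> = dual_integrand f g \<alpha> y0 \<psi> x"
    unfolding dual_value_def using x by (intro Least_equality) auto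
  then show "dual_value Y U f g \<alpha> y0 \<psi> \<in> dual_integrand f g \<alpha> y0 \<psi> ` control_graph Y U f"
    "p \<in> control_graph Y U f \<Longrightarrow> dual_value Y U f g \<alpha> y0 \<psi> \<le> dual_integrand f g \<alpha> y0 \<psi> p"
    using x by auto
qed

theorem proposition5:
  fixes Y :: "(real ^ 'm) set"
    and U0 :: "'u::metric_space set"
    and U :: "real ^ 'm \<Rightarrow> 'u set"
    and f :: "(real ^ 'm) \<times> 'u \<Rightarrow> real ^ 'm"
    and g :: "(real ^ 'm) \<times> 'u \<Rightarrow> real"
    and \<alpha> :: real
    and \<phi> :: "nat \<Rightarrow> real ^ 'm \<Rightarrow> real"
    and y0 :: "real ^ 'm"
  assumes "compact Y" and "Y \<noteq> {}"
    and "compact U0"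
    and "\<And>y. y \<in> Y \<Longrightarrow> U y \<subseteq> U0 \<and> compact (U y)"
    and "usc_on Y U0 U"
    and "continuous_on (UNIV \<times> U0) f"
    and "continuous_on (UNIV \<times> U0) g"
    and "0 < \<alpha>" and "\<alpha> < 1"
    and "\<And>y. y \<in> Y \<Longrightarrow> admissible_controls Y U f y \<noteq> {}"
    and "\<And>i. i \<ge> 1 \<Longrightarrow> continuous_on Y (\<phi> i)"
    and "\<And>y. y \<in> Y \<Longrightarrow> \<phi> 1 y = 1"
    and "locally_independent Y \<phi>"
    and "uniformly_spanning Y \<phi>"
    and "y0 \<in> Y"
    and "interior (closure (reachable_set Y U f y0)) \<noteq> {}"
  shows "\<forall>N\<ge>1. \<exists>\<psi>\<in>test_space \<phi> N.
    ereal (dual_value Y U f g \<alpha> y0 \<psi>) = approx_value Y U f g \<alpha> \<phi> N y0"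
proof (intro allI impI)
  fix N :: nat assume N: "1 \<le> N"
  let ?G = "control_graph Y U f"
  note Y = assms(1,2) and \<alpha> = assms(8,9) and ne = assms(10) and \<phi> = assms(11) and \<phi>1 = assms(12)
  have contf: "continuous_on (Y \<times> U0) f" and contg: "continuous_on (Y \<times> U0) g"
    using assms(6,7) by (auto elim!: continuous_on_subset)
  have cG: "compact ?G" using compact_control_graph assms(1,3,4,5) contf by blast
  have neG: "?G \<noteq> {}" using ne Y by (fastforce simp: control_graph_def)
  have sub: "?G \<subseteq> Y \<times> U0"
    using assms(4) by (auto simp: control_graph_def admissible_controls_def)
  have fY: "f ` ?G \<subseteq> Y" "fst ` ?G \<subseteq> Y"
    by (auto simp: control_graph_def admissible_controls_def)
  have fG: "continuous_on ?G f" and gG: "continuous_on ?G g"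
    using contf contg sub by (auto elim!: continuous_on_subset)
  \<comment> \<open>\<open>l i\<close> is the factor of \<open>c i\<close> when the integrand is
    expanded in the coefficients.\<close>
  define l where "l i p = \<alpha> * (\<phi> i (f p) - \<phi> i (fst p)) + (1 - \<alpha>) * (\<phi> i y0 - \<phi> i (fst p))"
    for i and p :: "(real ^ 'm) \<times> 'u"
  have lG: "continuous_on ?G (l i)" if "i \<ge> 1" for i
  proof -
    have "continuous_on ?G (\<lambda>p. \<phi> i (f p))" "continuous_on ?G (\<lambda>p. \<phi> i (fst p))"
      using continuous_on_compose2[OF \<phi>[OF that]] fG fY continuous_on_fst[OF continuous_on_id]
      by blast+
    then show ?thesis unfolding l_def by (intro continuous_intros)
  qed
  define \<Psi> where "\<Psi> c y = (\<Sum>i=1..N. c i * \<phi> i y)" for c y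
  have split1: "{1..N} = insert 1 {2..N}" using N by auto
  have linear: "\<alpha> * (\<Psi> c (f p) - \<Psi> c (fst p)) + (1 - \<alpha>) * (\<Psi> c y0 - \<Psi> c (fst p))
      = (\<Sum>i=2..N. c i * l i p)" if "p \<in> ?G" for c p
  proof -
    have "\<alpha> * (\<Psi> c (f p) - \<Psi> c (fst p)) + (1 - \<alpha>) * (\<Psi> c y0 - \<Psi> c (fst p))
      = (\<Sum>i=1..N. c i * l i p)"
      unfolding \<Psi>_def l_def
      by (simp add: sum_subtractf[symmetric] sum_distrib_left sum.distrib[symmetric] algebra_simps)
    \<comment> \<open>As \<open>\<phi> 1\<close> is constant on \<open>Y\<close>, its coefficient
      has no effect, and sums may start at 2.\<close>
    moreover have "l 1 p = 0" using \<phi>1 fY that assms(15) by (auto simp: l_def image_subset_iff)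
    ultimately show ?thesis unfolding split1 by simp
  qed
  have integrand: "dual_integrand f g \<alpha> y0 (\<Psi> c) p = g p + (\<Sum>i=2..N. c i * l i p)"
    if "p \<in> ?G" for c p
    using linear[OF that, of c] by (simp add: dual_integrand_def split_beta)
  have cont: "continuous_on ?G (dual_integrand f g \<alpha> y0 (\<Psi> c))" for c
  proof -
    have "continuous_on ?G (\<lambda>p. g p + (\<Sum>i=2..N. c i * l i p))"
      by (intro continuous_intros gG lG) auto
    then show ?thesis using integrand by (simp cong: continuous_on_cong)
  qed
  have nondeg: "c i = 0" if nonneg: "\<And>p. p \<in> ?G \<Longrightarrow> 0 \<le> (\<Sum>j=2..N. c j * l j p)" and "i \<in> {2..N}"
    for c :: "nat \<Rightarrow> real" and i
  proof -
    \<comment> \<open>Subtracting the value at \<open>y0\<close> absorbs the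
      \<open>(1 - \<alpha>)\<close> term: the linear part becomes
      \<open>\<alpha> * \<theta> (f p) - \<theta> (fst p)\<close> for
      \<open>\<theta> = \<Psi> c - k\<close>.\<close>
    define k where "k = \<Psi> c y0"
    let ?R = "reachable_set Y U f y0"
    have zero: "\<Psi> c y - k = 0" if "y \<in> closure ?R" for y
    proof (rule discounted_increase_vanishes[where Y = Y and \<theta> = "\<lambda>y. \<Psi> c y - k"])
      show "continuous_on Y (\<lambda>y. \<Psi> c y - k)"
        unfolding \<Psi>_def by (intro continuous_intros \<phi>) auto
      show "\<Psi> c y - k \<le> \<alpha> * (\<Psi> c (f (y, u)) - k)" if "(y, u) \<in> ?G" for y u
        using nonneg[OF that] linear[OF that, of c] by (simp add: k_def algebra_simps)
    qed (use Y \<alpha> ne assms(15) that in \<open>auto simp: k_def compact_imp_closed\<close>)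
    let ?Q = "interior (closure ?R)"
    have QY: "?Q \<subseteq> Y"
      using closure_minimal[OF reachable_set_subset[OF assms(15)] compact_imp_closed[OF Y(1)]]
        interior_subset by blast
    \<comment> \<open>Since \<open>\<phi> 1\<close> is 1 on \<open>Y\<close>, the constant
      \<open>k\<close> is absorbed into the first coefficient. Independence on \<open>?Q\<close>
      then kills all of \<open>?d\<close>, which agrees with \<open>c\<close> from index 2
      on.\<close>
    let ?d = "c(1 := c 1 - k)"
    have "(\<Sum>i\<in>{1..N}. ?d i * \<phi> i y) = 0" if "y \<in> ?Q" for y
    proof -
      have "(\<Sum>i\<in>{2..N}. ?d i * \<phi> i y) = (\<Sum>i\<in>{2..N}. c i * \<phi> i y)"
        by (rule sum.cong) auto
      then have "(\<Sum>i\<in>{1..N}. ?d i * \<phi> i y) = \<Psi> c y - k"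
        using \<phi>1[of y] QY that unfolding \<Psi>_def split1 by (auto simp: algebra_simps)
      then show ?thesis using zero[of y] that interior_subset by auto
    qed
    moreover have "finite {1..N}" "{1..N} \<subseteq> {1..}" by auto
    ultimately have "\<forall>i\<in>{1..N}. ?d i = 0"
      using assms(13,16) QY open_interior[of "closure ?R"] unfolding locally_independent_def by blast
    then show ?thesis using \<open>i \<in> {2..N}\<close> by (auto dest: bspec[of _ _ i])
  qed
  obtain c where c: "\<And>c'. \<exists>p'\<in>?G. \<forall>p\<in>?G.
      g p' + (\<Sum>i=2..N. c' i * l i p') \<le> g p + (\<Sum>i=2..N. c i * l i p)"
    using linear_max_min_attained[OF cG neG _ gG, of "{2..N}" l] lG nondeg by auto
  have best: "dual_value Y U f g \<alpha> y0 (\<Psi> c') \<le> dual_value Y U f g \<alpha> y0 (\<Psi> c)" for c'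
  proof -
    \<comment> \<open>At \<open>p'\<close> the integrand of \<open>\<Psi> c'\<close> lies below all
      values for \<open>\<Psi> c\<close>, hence below their attained minimum.\<close>
    obtain p' where p': "p' \<in> ?G" "\<And>p. p \<in> ?G \<Longrightarrow>
        dual_integrand f g \<alpha> y0 (\<Psi> c') p' \<le> dual_integrand f g \<alpha> y0 (\<Psi> c) p"
      using c[of c'] integrand by auto
    then show ?thesis
      using dual_value_attained[OF cG neG cont] by (smt (verit) imageE)
  qed
  have space: "test_space \<phi> N = range \<Psi>"
    by (auto simp: test_space_def \<Psi>_def fun_eq_iff image_def)
  show "\<exists>\<psi>\<in>test_space \<phi> N.
      ereal (dual_value Y U f g \<alpha> y0 \<psi>) = approx_value Y U f g \<alpha> \<phi> N y0"
  proof (intro bexI[of _ "\<Psi> c"] antisym)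
    show "ereal (dual_value Y U f g \<alpha> y0 (\<Psi> c)) \<le> approx_value Y U f g \<alpha> \<phi> N y0"
      unfolding approx_value_def space by (intro SUP_upper) auto
    show "approx_value Y U f g \<alpha> \<phi> N y0 \<le> ereal (dual_value Y U f g \<alpha> y0 (\<Psi> c))"
      unfolding approx_value_def space using best by (intro SUP_least) auto
  qed (simp add: space)
qed

end
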